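(* Let $b,c$ be positive integers with $\gcd(b,c)=1$, $b\ne 1$, $c\ne 1$, and $b+c=2^{2l-1}$ for an integer $l\ge 3$. Then: 1. For all integers $m\ge 1$, $n\ge 8$ with $2m+n=\frac{b+c-2}{3}$ there is a perfect coloring of $D(m,n)$ with quotient matrix $\begin{pmatrix} c-2 & b\\ c & b-2\end{pmatrix}$. 2. For $n=\frac{b+c+1}{3}$ there is a perfect coloring of the Hamming graph $H(n,4)$ with quotient matrix $\begin{pmatrix} c+1 & b\\ c & b+1\end{pmatrix}$.
   Context: The Shrikhande graph is the Cayley graph on $\mathbb{Z}_4^2$ with connection set $\{01,03,10,30,11,33\}$. For nonnegative integers $m,n$, $D(m,n)$ is the Cartesian product of $m$ copies of the Shrikhande graph and $n$ copies of $K_4$ (vertex set $(\mathbb{Z}_4^2)^m\times\mathbb{Z}_4^n$; adjacent iff differing in exactly one coordinate by an adjacency of that factor). $H(n,4)=D(0,n)$ is the Cartesian product of $n$ copies of $K_4$. A $2$-coloring (surjective map onto colors $\{1,2\}$) is perfect with quotient matrix $(s_{ij})$ if every vertex of color $i$ has exactly $s_{ij}$ neighbours of color $j$. *)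

theory Defs
  imports "HOL-Analysis.Analysis"
begin

text \<open>The numeral type \<open>4\<close> carries arithmetic modulo 4, so it is the ring of integers modulo 4.\<close>

type_synonym z4 = "4"

definition shrikhande_connection :: "(z4 \<times> z4) set" where
  "shrikhande_connection = {(0,1), (0,3), (1,0), (3,0), (1,1), (3,3)}"

definition shrikhande_adj :: "z4 \<times> z4 \<Rightarrow> z4 \<times> z4 \<Rightarrow> bool" where
  "shrikhande_adj x y \<longleftrightarrow> y - x \<in> shrikhande_connection"

definition K4_adj :: "z4 \<Rightarrow> z4 \<Rightarrow> bool" where
  "K4_adj x y \<longleftrightarrow> x \<noteq> y"

text \<open>Tuples are functions on an initial segment of the naturals, extended by \<open>undefined\<close>.\<close>

type_synonym D_vertex = "(nat \<Rightarrow> z4 \<times> z4) \<times> (nat \<Rightarrow> z4)"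

definition D_verts :: "nat \<Rightarrow> nat \<Rightarrow> D_vertex set" where
  "D_verts m n = ({..<m} \<rightarrow>\<^sub>E UNIV) \<times> ({..<n} \<rightarrow>\<^sub>E UNIV)"

definition D_adj :: "nat \<Rightarrow> nat \<Rightarrow> D_vertex \<Rightarrow> D_vertex \<Rightarrow> bool" where
  "D_adj m n = (\<lambda>(x, u) (y, v).
     ((\<exists>i<m. shrikhande_adj (x i) (y i) \<and> (\<forall>j<m. j \<noteq> i \<longrightarrow> x j = y j))
        \<and> (\<forall>j<n. u j = v j)) \<or>
     ((\<forall>j<m. x j = y j)
        \<and> (\<exists>i<n. K4_adj (u i) (v i) \<and> (\<forall>j<n. j \<noteq> i \<longrightarrow> u j = v j))))"

abbreviation hamming4_verts :: "nat \<Rightarrow> D_vertex set" where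
  "hamming4_verts n \<equiv> D_verts 0 n"

abbreviation hamming4_adj :: "nat \<Rightarrow> D_vertex \<Rightarrow> D_vertex \<Rightarrow> bool" where
  "hamming4_adj n \<equiv> D_adj 0 n"

text \<open>The two colours are the elements \<open>1\<close> and \<open>2\<close> of the numeral type \<open>2\<close> (where \<open>2 = 0\<close>),
  which is also the index type of the quotient matrix. Only the values of \<open>f\<close> on \<open>V\<close> matter.\<close>

definition perfect_2_coloring ::
    "'v set \<Rightarrow> ('v \<Rightarrow> 'v \<Rightarrow> bool) \<Rightarrow> ('v \<Rightarrow> 2) \<Rightarrow> int^2^2 \<Rightarrow> bool" where
  "perfect_2_coloring V adj f S \<longleftrightarrow>
     f ` V = {1, 2} \<and>
     (\<forall>x\<in>V. \<forall>j. int (card {y \<in> V. adj x y \<and> f y = j}) = S $ f x $ j)"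

end

theory Submission
  imports Defs
begin

text \<open>The vertex set is split as \<open>B \<times> Y\<close>, where \<open>B\<close> is one Shrikhande factor (first claim)
  or \<open>K\<^sub>4\<^sup>3\<close> (second claim). With \<open>k = l - 2\<close>, the factor \<open>Y\<close> carries a map \<open>(z, \<theta>)\<close> to
  \<open>4\<^sup>k\<close> parts of size 8 such that every vertex sees every colour outside its own part exactly
  once and no colour of its own part. On \<open>B\<close>, for each \<open>a \<in> {0, 3, 4, 5, 8}\<close>, there are 8
  perfect colourings of density \<open>a/8\<close> with eigenvalue \<open>e\<close> (\<open>- 2\<close> and \<open>1\<close>, respectively) that
  together cover every vertex \<open>a\<close> times. Giving part \<open>z\<close> a density \<open>d z\<close> and letting \<open>\<theta>\<close> select
  one of the 8 colourings, a vertex gets \<open>d z + e [col]\<close> coloured neighbours inside \<open>B\<close> and \<open>d z'\<close>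
  from every other part \<open>z'\<close>, hence \<open>c + e [col]\<close> as soon as the densities sum to \<open>c\<close>.

  The map on \<open>Y\<close> is built by recursion on \<open>k\<close>: every \<open>K\<^sub>4\<close> coordinate of a Hamming graph with such
  a map is replaced by a block mapping equitably onto the complete multipartite graph \<open>K\<^sub>4\<^sub>,\<^sub>4\<^sub>,\<^sub>4\<^sub>,\<^sub>4\<close>, and
  8 further \<open>K\<^sub>4\<close> coordinates split the resulting parts of size 32. A block consists of four \<open>K\<^sub>4\<close>,
  of a Shrikhande graph and two \<open>K\<^sub>4\<close>, or of two Shrikhande graphs.\<close>

subsection \<open>The residues modulo 2 and 4\<close>

type_synonym v4 = "2 \<times> 2"
type_synonym v8 = "2 \<times> 2 \<times> 2"

lemma UNIV_z2: "(UNIV :: 2 set) = {0, 1}"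
  using UNIV_2 by auto

lemma UNIV_z4: "(UNIV :: z4 set) = {0, 1, 2, 3}"
  using UNIV_4 by auto

lemma all_z2: "(\<forall>x :: 2. P x) \<longleftrightarrow> P 0 \<and> P 1"
  by (metis (full_types) UNIV_I UNIV_z2 insertE singletonD)

lemma all_z4: "(\<forall>x :: z4. P x) \<longleftrightarrow> P 0 \<and> P 1 \<and> P 2 \<and> P 3"
  by (metis (full_types) UNIV_I UNIV_z4 insertE singletonD)

lemma Compl_z4:
  "- {0 :: z4} = {1, 2, 3}" "- {1 :: z4} = {0, 2, 3}"
  "- {2 :: z4} = {0, 1, 3}" "- {3 :: z4} = {0, 1, 2}"
  unfolding Compl_eq_Diff_UNIV UNIV_z4 by auto

lemma UNIV_v8: "(UNIV :: v8 set) =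
    {(0,0,0), (0,0,1), (0,1,0), (0,1,1), (1,0,0), (1,0,1), (1,1,0), (1,1,1)}"
  unfolding UNIV_Times_UNIV[symmetric] UNIV_z2 by auto

lemma sum_v8: "(\<Sum>t\<in>UNIV. f (t :: v8)) = f (0,0,0) + f (0,0,1) + f (0,1,0) + f (0,1,1) +
    f (1,0,0) + f (1,0,1) + f (1,1,0) + f (1,1,1)"
  by (simp add: UNIV_v8 add_ac)

text \<open>A bijection but no homomorphism: it turns \<open>K4\<close> into the Cayley graph on a
  plane over the field with two elements in which any two vectors are joined. The first bit of
  \<open>enc x\<close> is the parity of \<open>x\<close>.\<close>

definition enc :: "z4 \<Rightarrow> v4" where
  "enc x = (if x = 0 then (0,0) else if x = 1 then (1,0) else if x = 2 then (0,1) else (1,1))"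

definition dec :: "v4 \<Rightarrow> z4" where
  "dec p = (if p = (0,0) then 0 else if p = (1,0) then 1 else if p = (0,1) then 2 else 3)"

lemma dec_enc [simp]: "dec (enc x) = x"
proof -
  have "\<forall>x. dec (enc x) = x"
    unfolding all_z4 by (simp add: enc_def dec_def)
  then show ?thesis by blast
qed

lemma enc_dec [simp]: "enc (dec p) = p"
proof -
  have "\<forall>p. enc (dec p) = p"
    by (simp only: split_paired_All all_z2) (simp add: enc_def dec_def)
  then show ?thesis by blast
qed

lemma bij_enc: "bij enc"
  by (rule bijI', metis dec_enc, metis enc_dec)

lemma dec_eq_iff: "dec p = dec q \<longleftrightarrow> p = q" and enc_eq_iff: "enc x = p \<longleftrightarrow> x = dec p"
  by (metis enc_dec) (metis enc_dec dec_enc)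

section \<open>Sums over translates and over families of lines\<close>

lemma sum_translate:
  fixes c :: "'a::{finite,ab_group_add}"
  shows "(\<Sum>t\<in>UNIV. f (c + t)) = (\<Sum>t\<in>UNIV. f t)"
  by (rule sum.reindex_bij_witness[where i = "\<lambda>t. t - c" and j = "\<lambda>t. c + t"]) auto

lemma sum_translate_nonzero:
  fixes c :: "'a::ab_group_add"
  shows "(\<Sum>s\<in>-{0}. f (c + s)) = (\<Sum>s\<in>-{c}. f s)"
  by (rule sum.reindex_bij_witness[where i = "\<lambda>t. t - c" and j = "\<lambda>t. c + t"]) auto

lemma sum_fun_upd:
  fixes g :: "nat \<Rightarrow> 'a \<Rightarrow> 'b::ab_group_add"
  assumes "j < N"
  shows "(\<Sum>i<N. g i ((w(j := a)) i)) = (\<Sum>i<N. g i (w i)) + (g j a - g j (w j))"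
proof -
  have "(\<Sum>i<N. g i ((w(j := a)) i)) = g j a + (\<Sum>i\<in>{..<N}-{j}. g i (w i))"
    using assms by (subst sum.remove[of _ j]) (auto intro!: sum.cong)
  moreover have "(\<Sum>i<N. g i (w i)) = g j (w j) + (\<Sum>i\<in>{..<N}-{j}. g i (w i))"
    using assms by (subst sum.remove[of _ j]) auto
  ultimately show ?thesis by (simp add: algebra_simps)
qed

text \<open>The coordinate \<open>j\<close> moves the pair of sums along the line \<open>{(s, A j s)}\<close>; for each fixed \<open>s \<noteq> 0\<close>
  these lines cover every second component once.\<close>

lemma sum_lines:
  fixes A :: "nat \<Rightarrow> v4 \<Rightarrow> 't::{finite,ab_group_add}" and F :: "v4 \<Rightarrow> 't \<Rightarrow> 'b::comm_monoid_add"
  assumes add: "\<And>j s t. A j (s + t) = A j s + A j t"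
    and bij: "\<And>s. s \<noteq> 0 \<Longrightarrow> bij_betw (\<lambda>j. A j s) {..<N} UNIV"
  shows "(\<Sum>j<N. \<Sum>a\<in>-{w j}. F (\<Sum>i<N. enc ((w(j := a)) i)) (\<Sum>i<N. A i (enc ((w(j := a)) i))))
    = (\<Sum>s\<in>-{\<Sum>i<N. enc (w i)}. \<Sum>t\<in>UNIV. F s t)"
proof -
  define Z where "Z = (\<Sum>i<N. enc (w i))"
  define T where "T = (\<Sum>i<N. A i (enc (w i)))"
  have diff: "A j x - A j y = A j (x - y)" for j x y
    using add[of j "x - y" y] by simp
  have "(\<Sum>a\<in>-{w j}. F (\<Sum>i<N. enc ((w(j := a)) i)) (\<Sum>i<N. A i (enc ((w(j := a)) i))))
    = (\<Sum>s\<in>-{0}. F (Z + s) (T + A j s))" if "j < N" for j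
  proof -
    have "(\<Sum>a\<in>-{w j}. F (\<Sum>i<N. enc ((w(j := a)) i)) (\<Sum>i<N. A i (enc ((w(j := a)) i))))
      = (\<Sum>a\<in>-{w j}. F (Z + (enc a - enc (w j))) (T + A j (enc a - enc (w j))))"
      using sum_fun_upd[OF that, of "\<lambda>_. enc" w] sum_fun_upd[OF that, of "\<lambda>i x. A i (enc x)" w]
      by (simp add: Z_def T_def diff)
    \<comment> \<open>As \<open>a\<close> runs over the values other than \<open>w j\<close>,
      \<open>enc a - enc (w j)\<close> runs over the nonzero vectors.\<close>
    also have "\<dots> = (\<Sum>s\<in>-{0}. F (Z + s) (T + A j s))"
      by (rule sum.reindex_bij_witness[where i = "\<lambda>s. dec (s + enc (w j))" and j = "\<lambda>a. enc a - enc (w j)"])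
        (auto, metis dec_enc, metis add_0 enc_dec add.commute add_right_cancel)
    finally show ?thesis .
  qed
  then have "(\<Sum>j<N. \<Sum>a\<in>-{w j}. F (\<Sum>i<N. enc ((w(j := a)) i)) (\<Sum>i<N. A i (enc ((w(j := a)) i))))
    = (\<Sum>j<N. \<Sum>s\<in>-{0}. F (Z + s) (T + A j s))"
    by simp
  also have "\<dots> = (\<Sum>s\<in>-{0}. \<Sum>j<N. F (Z + s) (T + A j s))"
    by (rule sum.swap)
  also have "\<dots> = (\<Sum>s\<in>-{0}. \<Sum>t\<in>UNIV. F (Z + s) t)"
  proof (rule sum.cong[OF refl])
    fix s :: v4 assume "s \<in> -{0}"
    then have "(\<Sum>j<N. F (Z + s) (T + A j s)) = (\<Sum>t\<in>UNIV. F (Z + s) (T + t))"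
      using sum.reindex_bij_betw[OF bij[of s], of "\<lambda>t. F (Z + s) (T + t)"] by simp
    then show "(\<Sum>j<N. F (Z + s) (T + A j s)) = (\<Sum>t\<in>UNIV. F (Z + s) t)"
      by (simp add: sum_translate)
  qed
  also have "\<dots> = (\<Sum>s\<in>-{Z}. \<Sum>t\<in>UNIV. F s t)"
    by (rule sum_translate_nonzero)
  finally show ?thesis
    unfolding Z_def .
qed

text \<open>On the three nonzero \<open>s\<close>, \<open>A j\<close> takes the values
  \<open>g j\<close>, \<open>\<theta> (g j)\<close> and their sum, where \<open>g\<close> enumerates
  the group. The two injectivities make each of these a bijection in \<open>j\<close>;
  characteristic 2 makes \<open>A j\<close> additive.\<close>

lemma exists_lines:
  fixes \<theta> :: "'t::{finite,ab_group_add} \<Rightarrow> 't"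
  assumes char2: "\<And>t :: 't. t + t = 0"
    and inj: "inj \<theta>" "inj (\<lambda>t. t + \<theta> t)"
  shows "\<exists>A :: nat \<Rightarrow> v4 \<Rightarrow> 't. (\<forall>j s t. A j (s + t) = A j s + A j t) \<and>
    (\<forall>s. s \<noteq> 0 \<longrightarrow> bij_betw (\<lambda>j. A j s) {..<CARD('t)} UNIV)"
proof -
  obtain g :: "nat \<Rightarrow> 't" where g: "bij_betw g {..<CARD('t)} UNIV"
    using ex_bij_betw_nat_finite[of "UNIV :: 't set"] by (auto simp: atLeast0LessThan)
  define A where "A j s = (if fst s = 1 then g j else 0) + (if snd s = 1 then \<theta> (g j) else 0)"
    for j and s :: v4
  have bij: "bij_betw (\<lambda>j. f (g j)) {..<CARD('t)} UNIV" if "inj f" for f :: "'t \<Rightarrow> 't"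
    using bij_betw_trans[OF g, of f UNIV] that
    by (simp add: comp_def bij_def finite_UNIV_inj_surj)
  have "\<forall>j s t. A j (s + t) = A j s + A j t"
    using char2[of "g _"] char2[of "\<theta> (g _)"]
    by (simp add: A_def split_paired_All all_z2 add.left_commute add.commute)
  moreover have "\<forall>s. s \<noteq> 0 \<longrightarrow> bij_betw (\<lambda>j. A j s) {..<CARD('t)} UNIV"
    using g bij[OF inj(1)] bij[OF inj(2)] by (simp add: A_def split_paired_All all_z2 zero_prod_def)
  ultimately show ?thesis by blast
qed

text \<open>Here \<theta> is multiplication by a root of \<open>X^2 + X + 1\<close> in the field
  with 4 elements.\<close>

lemma lines_v4:
  obtains A :: "nat \<Rightarrow> v4 \<Rightarrow> v4"
  where "\<And>j s t. A j (s + t) = A j s + A j t"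
    and "\<And>s. s \<noteq> 0 \<Longrightarrow> bij_betw (\<lambda>j. A j s) {..<4} UNIV"
proof -
  define \<theta> :: "v4 \<Rightarrow> v4" where "\<theta> = (\<lambda>(a, b). (b, a + b))"
  have "\<forall>t :: v4. t + t = 0"
    by (simp only: split_paired_All all_z2) (simp add: zero_prod_def)
  moreover have "inj \<theta>" "inj (\<lambda>t. t + \<theta> t)"
    by (simp_all add: inj_def split_paired_All all_z2 \<theta>_def)
  ultimately show ?thesis
    using exists_lines[of \<theta>] that by (simp del: split_paired_All) blast
qed

text \<open>The map \<open>\<theta>\<close> is multiplication by a root of \<open>X\<^sup>3 + X + 1\<close> in the field with 8 elements.\<close>

lemma lines_v8:
  obtains A :: "nat \<Rightarrow> v4 \<Rightarrow> v8"
  where "\<And>j s t. A j (s + t) = A j s + A j t"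
    and "\<And>s. s \<noteq> 0 \<Longrightarrow> bij_betw (\<lambda>j. A j s) {..<8} UNIV"
proof -
  define \<theta> :: "v8 \<Rightarrow> v8" where "\<theta> = (\<lambda>(a, b, c). (c, a + c, b))"
  have "\<forall>t :: v8. t + t = 0"
    by (simp only: split_paired_All all_z2) (simp add: zero_prod_def)
  moreover have "inj \<theta>" "inj (\<lambda>t. t + \<theta> t)"
    by (simp_all add: inj_def split_paired_All all_z2 \<theta>_def)
  ultimately show ?thesis
    using exists_lines[of \<theta>] that by (simp del: split_paired_All) blast
qed

subsection \<open>Colourings of the small factor\<close>

text \<open>The operator \<open>S\<close> is the sum over the neighbours of a vertex.\<close>

definition balanced_family :: "(('v \<Rightarrow> int) \<Rightarrow> 'v \<Rightarrow> int) \<Rightarrow> int \<Rightarrow> int \<Rightarrow> bool" where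
  "balanced_family S e a \<longleftrightarrow> (\<exists>C :: v8 \<Rightarrow> 'v \<Rightarrow> bool.
     (\<forall>t v. S (\<lambda>w. of_bool (C t w)) v = a + e * of_bool (C t v)) \<and>
     (\<forall>v. (\<Sum>t\<in>UNIV. of_bool (C t v)) = a))"

text \<open>The assumption on \<open>S\<close> expresses regularity of degree \<open>8 + e\<close>:
  6 for the Shrikhande graph with \<open>e = -2\<close>, 9 for the cube of \<open>K4\<close> with
  \<open>e = 1\<close>. Complementing each colouring keeps \<open>e\<close>.\<close>

lemma balanced_family_complement:
  assumes "balanced_family S e a"
    and S: "\<And>f v. S (\<lambda>w. 1 - f w) v = 8 + e - S f v"
  shows "balanced_family S e (8 - a)"
proof -
  obtain C :: "v8 \<Rightarrow> 'a \<Rightarrow> bool" where C: "\<forall>t v. S (\<lambda>w. of_bool (C t w)) v = a + e * of_bool (C t v)"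
    "\<forall>v. (\<Sum>t\<in>UNIV. of_bool (C t v)) = a"
    using assms(1) unfolding balanced_family_def by blast
  have "(\<forall>t v. S (\<lambda>w. of_bool (\<not> C t w)) v = (8 - a) + e * of_bool (\<not> C t v)) \<and>
     (\<forall>v. (\<Sum>t\<in>UNIV. of_bool (\<not> C t v)) = 8 - a)"
    using C by (simp add: of_bool_not_iff S sum_subtractf algebra_simps)
  then show ?thesis
    unfolding balanced_family_def by (intro exI[of _ "\<lambda>t v. \<not> C t v"])
qed

lemma balanced_family_const:
  assumes S: "\<And>f v. S (\<lambda>w. 1 - f w) v = 8 + e - S f v" and S0: "\<And>v. S (\<lambda>_. 0) v = 0"
  shows "balanced_family S e 0" "balanced_family S e 8"
proof -
  show "balanced_family S e 0"
    unfolding balanced_family_def by (rule exI[of _ "\<lambda>_ _. False"]) (simp add: S0)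
  then show "balanced_family S e 8"
    using balanced_family_complement[of S e 0] S by simp
qed

definition shrikhande_sum :: "(z4 \<times> z4 \<Rightarrow> int) \<Rightarrow> z4 \<times> z4 \<Rightarrow> int" where
  "shrikhande_sum F v = (\<Sum>s\<in>shrikhande_connection. F (v + s))"

definition K4_cube_sum :: "(z4 \<times> z4 \<times> z4 \<Rightarrow> int) \<Rightarrow> z4 \<times> z4 \<times> z4 \<Rightarrow> int" where
  "K4_cube_sum F = (\<lambda>(x, y, z). (\<Sum>a\<in>-{x}. F (a, y, z)) + (\<Sum>a\<in>-{y}. F (x, a, z)) + (\<Sum>a\<in>-{z}. F (x, y, a)))"

lemma shrikhande_sum_expand: "shrikhande_sum F (x, y) =
    F (x, y + 1) + F (x, y + 3) + F (x + 1, y) + F (x + 3, y) + F (x + 1, y + 1) + F (x + 3, y + 3)"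
  by (simp add: shrikhande_sum_def shrikhande_connection_def)

lemma shrikhande_sum_shift: "shrikhande_sum (\<lambda>w. F (w + c)) v = shrikhande_sum F (v + c)"
  by (simp add: shrikhande_sum_def add_ac)

text \<open>That \<open>T\<close> is perfect is checked by evaluation, and translations are
  automorphisms. The first coordinates 0, 1, 2, 3 occur 2, 1, 2, 1 times in \<open>T\<close>, so two
  consecutive ones always account for three points; hence the translates by
  \<open>{0, 1} \<times> UNIV\<close> cover every vertex 3 times.\<close>

lemma shrikhande_family_3: "balanced_family shrikhande_sum (- 2) 3"
proof -
  define T :: "(z4 \<times> z4) set" where "T = {(0,0), (0,1), (1,3), (2,0), (2,2), (3,2)}"
  define h :: "v8 \<Rightarrow> z4 \<times> z4" where "h = (\<lambda>(p, q). (if p = 0 then 0 else 1, dec q))"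
  have "\<forall>v. shrikhande_sum (\<lambda>w. of_bool (w \<in> T)) v = 3 - 2 * of_bool (v \<in> T)"
    by (simp only: split_paired_All all_z4 shrikhande_sum_expand) (simp add: T_def)
  then have "shrikhande_sum (\<lambda>w. of_bool (w + h t \<in> T)) v = 3 - 2 * of_bool (v + h t \<in> T)" for t v
    using shrikhande_sum_shift[of "\<lambda>w. of_bool (w \<in> T)"] by (simp del: split_paired_All)
  moreover have "\<forall>v. (\<Sum>t\<in>UNIV. of_bool (v + h t \<in> T)) = (3 :: int)"
    by (simp only: split_paired_All all_z4 sum_v8) (simp add: T_def h_def dec_def)
  ultimately show ?thesis
    unfolding balanced_family_def by (intro exI[of _ "\<lambda>t v. v + h t \<in> T"]) simp
qed

text \<open>Two elements of the connection set keep the parity of the first coordinate and four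
  change it. Half of the indices \<open>t\<close> give a parity class, the other half its
  complement.\<close>

lemma shrikhande_family_4: "balanced_family shrikhande_sum (- 2) 4"
proof -
  define C :: "v8 \<Rightarrow> z4 \<times> z4 \<Rightarrow> bool" where "C = (\<lambda>t v. (fst t = 0) = (fst v \<in> {0, 2}))"
  have "\<forall>t v. shrikhande_sum (\<lambda>w. of_bool (C t w)) v = 4 + (- 2) * of_bool (C t v)"
    by (simp only: split_paired_All all_z4 all_z2) (simp add: shrikhande_sum_def shrikhande_connection_def C_def)
  moreover have "\<forall>v. (\<Sum>t\<in>UNIV. of_bool (C t v)) = (4 :: int)"
    by (simp only: split_paired_All all_z4 sum_v8) (simp add: C_def)
  ultimately show ?thesis
    unfolding balanced_family_def by blast
qed

text \<open>The first coordinates 0, 1, 2, 3 occur 3, 1, 1, 1 times in each layer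
  \<open>z = 0, 1\<close> of \<open>T\<close> and 0, 2, 2, 2 times in each layer
  \<open>z = 2, 3\<close>. The translations move \<open>y\<close> freely and reach one layer of
  either kind, so every vertex is covered 3 times.\<close>

lemma K4_cube_family_3: "balanced_family K4_cube_sum 1 3"
proof -
  define T :: "(z4 \<times> z4 \<times> z4) set" where "T = {(x, y, z). (x, y) \<in> (if z \<in> {0, 1}
     then {(0,0), (0,2), (0,3), (1,2), (2,3), (3,0)} else {(1,1), (1,2), (2,1), (2,3), (3,0), (3,1)})}"
  define h :: "v8 \<Rightarrow> z4 \<times> z4 \<times> z4" where "h = (\<lambda>(p, q). (0, dec q, if p = 0 then 0 else 2))"
  have T: "\<forall>v. K4_cube_sum (\<lambda>w. of_bool (w \<in> T)) v = 3 + of_bool (v \<in> T)"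
    by (simp only: split_paired_All all_z4) (simp add: K4_cube_sum_def T_def Compl_z4)
  have shift: "K4_cube_sum (\<lambda>w. F (w + c)) v = K4_cube_sum F (v + c)" for F c v
  proof -
    have *: "(\<Sum>a\<in>-{x}. f (a + d)) = (\<Sum>a\<in>-{x + d}. f a)" for x d :: z4 and f :: "z4 \<Rightarrow> int"
      by (rule sum.reindex_bij_witness[where i = "\<lambda>a. a - d" and j = "\<lambda>a. a + d"]) auto
    show ?thesis
      by (cases v; cases c) (simp add: K4_cube_sum_def *[of "\<lambda>a. F (a, _)"]
        *[of "\<lambda>a. F (_, a, _)"] *[of "\<lambda>a. F (_, _, a)"])
  qed
  have "\<forall>v. (\<Sum>t\<in>UNIV. of_bool (v + h t \<in> T)) = (3 :: int)"
    by (simp only: split_paired_All all_z4 sum_v8) (simp add: T_def h_def dec_def)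
  then show ?thesis
    unfolding balanced_family_def using T shift[of "\<lambda>w. of_bool (w \<in> T)"]
    by (intro exI[of _ "\<lambda>t v. v + h t \<in> T"]) (simp del: split_paired_All)
qed

text \<open>The class is kept by all three steps in \<open>z\<close> and by one of three steps in
  \<open>x\<close> and in \<open>y\<close>, so a vertex has 5 neighbours in its own class and 4 in
  the other.\<close>

lemma K4_cube_family_4: "balanced_family K4_cube_sum 1 4"
proof -
  define C :: "v8 \<Rightarrow> z4 \<times> z4 \<times> z4 \<Rightarrow> bool"
    where "C = (\<lambda>t (x, y, z). (fst t = 0) = ((x \<in> {0, 1}) = (y \<in> {0, 1})))"
  have "\<forall>t v. K4_cube_sum (\<lambda>w. of_bool (C t w)) v = 4 + 1 * of_bool (C t v)"
    by (simp only: split_paired_All all_z4 all_z2) (simp add: K4_cube_sum_def C_def Compl_z4)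
  moreover have "\<forall>v. (\<Sum>t\<in>UNIV. of_bool (C t v)) = (4 :: int)"
    by (simp only: split_paired_All all_z4 sum_v8) (simp add: C_def)
  ultimately show ?thesis
    unfolding balanced_family_def by blast
qed

lemma shrikhande_families:
  assumes "a \<in> {0, 3, 4, 5, 8}"
  shows "balanced_family shrikhande_sum (- 2) a"
proof -
  have S: "shrikhande_sum (\<lambda>w. 1 - f w) v = 8 + (- 2) - shrikhande_sum f v" for f v
    by (simp add: shrikhande_sum_def sum_subtractf shrikhande_connection_def)
  have S0: "shrikhande_sum (\<lambda>_. 0) v = 0" for v
    by (simp add: shrikhande_sum_def)
  show ?thesis
    using assms balanced_family_const[of shrikhande_sum, OF S S0] shrikhande_family_3 shrikhande_family_4
      balanced_family_complement[OF shrikhande_family_3 S] by auto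
qed

lemma K4_cube_families:
  assumes "a \<in> {0, 3, 4, 5, 8}"
  shows "balanced_family K4_cube_sum 1 a"
proof -
  have card: "card (- {x :: z4}) = 3" for x
    unfolding Compl_eq_Diff_UNIV by (simp add: card_Diff_singleton)
  have S: "K4_cube_sum (\<lambda>w. 1 - f w) v = 8 + 1 - K4_cube_sum f v" for f v
    by (simp add: K4_cube_sum_def sum_subtractf card split: prod.split)
  have S0: "K4_cube_sum (\<lambda>_. 0) v = 0" for v
    by (simp add: K4_cube_sum_def split: prod.split)
  show ?thesis
    using assms balanced_family_const[of K4_cube_sum, OF S S0] K4_cube_family_3 K4_cube_family_4
      balanced_family_complement[OF K4_cube_family_3 S] by auto
qed

subsection \<open>Neighbour sums in \<open>D(m, n)\<close>\<close>

text \<open>Meaningful for arbitrary pairs of functions: entries beyond the first \<open>m\<close>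
  and \<open>n\<close> are carried along, so that further factors can be read off there.\<close>

definition nbsum :: "nat \<Rightarrow> nat \<Rightarrow> (D_vertex \<Rightarrow> int) \<Rightarrow> D_vertex \<Rightarrow> int" where
  "nbsum m n F = (\<lambda>(x, u). (\<Sum>i<m. shrikhande_sum (\<lambda>p. F (x(i := p), u)) (x i)) +
     (\<Sum>j<n. \<Sum>a\<in>-{u j}. F (x, u(j := a))))"

text \<open>Every neighbour arises from exactly one change of one coordinate: \<open>f\<close> and
  \<open>g\<close> are injective with disjoint images.\<close>

lemma card_D_neighbours:
  assumes v: "v \<in> D_verts m n"
  shows "int (card {w \<in> D_verts m n. D_adj m n v w \<and> P w}) = nbsum m n (\<lambda>w. of_bool (P w)) v"
proof -
  obtain x u where v_eq: "v = (x, u)" by fastforce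
  \<comment> \<open>Outside the index range all vertices agree, so agreement inside it gives
    equality of functions.\<close>
  have x: "x i = undefined" if "\<not> i < m" for i
    using v that by (auto simp: v_eq D_verts_def PiE_iff extensional_def)
  have u: "u i = undefined" if "\<not> i < n" for i
    using v that by (auto simp: v_eq D_verts_def PiE_iff extensional_def)
  define f where "f = (\<lambda>(i, s). (x(i := x i + s), u))"
  define g where "g = (\<lambda>(j, a). (x, u(j := a)))"
  define I where "I = {..<m} \<times> shrikhande_connection"
  define J where "J = (SIGMA j:{..<n}. -{u j})"
  have nz: "s \<noteq> (0, 0)" if "s \<in> shrikhande_connection" for s
    using that by (auto simp: shrikhande_connection_def)
  have fin_conn: "finite shrikhande_connection"
    by simp
  have "{w \<in> D_verts m n. D_adj m n v w} = f ` I \<union> g ` J" (is "?L = ?R")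
  proof
    show "?L \<subseteq> ?R"
    proof
      fix w assume "w \<in> ?L"
      moreover obtain y t where w: "w = (y, t)" by fastforce
      ultimately have adj: "D_adj m n (x, u) (y, t)"
        and y: "\<And>i. \<not> i < m \<Longrightarrow> y i = undefined" and t: "\<And>i. \<not> i < n \<Longrightarrow> t i = undefined"
        by (auto simp: v_eq D_verts_def PiE_iff extensional_def)
      from adj consider
        i where "i < m" "y i - x i \<in> shrikhande_connection" "\<And>j. j < m \<Longrightarrow> j \<noteq> i \<Longrightarrow> x j = y j"
          "\<And>j. j < n \<Longrightarrow> u j = t j"
        | i where "i < n" "u i \<noteq> t i" "\<And>j. j < n \<Longrightarrow> j \<noteq> i \<Longrightarrow> u j = t j" "\<And>j. j < m \<Longrightarrow> x j = y j"
        unfolding D_adj_def shrikhande_adj_def K4_adj_def by auto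
      then show "w \<in> ?R"
      proof cases
        case 1
        have "y = x(i := x i + (y i - x i))"
        proof
          fix j show "y j = (x(i := x i + (y i - x i))) j"
            using 1(3)[of j] x[of j] y[of j] by (cases "j < m") auto
        qed
        moreover have "t = u"
        proof
          fix j show "t j = u j" using 1(4)[of j] t[of j] u[of j] by (cases "j < n") auto
        qed
        ultimately have "w = f (i, y i - x i)" by (simp add: w f_def)
        then show ?thesis using 1(1,2) by (auto simp: I_def)
      next
        case 2
        have "t = u(i := t i)"
        proof
          fix j show "t j = (u(i := t i)) j"
            using 2(3)[of j] t[of j] u[of j] by (cases "j < n") auto
        qed
        moreover have "y = x"
        proof
          fix j show "y j = x j" using 2(4)[of j] x[of j] y[of j] by (cases "j < m") auto
        qed
        ultimately have "w = g (i, t i)" by (simp add: w g_def)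
        then show ?thesis using 2(1,2) by (auto simp: J_def)
      qed
    qed
    show "?R \<subseteq> ?L"
    proof
      fix w assume "w \<in> ?R"
      then consider p where "p \<in> I" "w = f p" | p where "p \<in> J" "w = g p"
        by blast
      then show "w \<in> ?L"
      proof cases
        case 1
        obtain i s where "p = (i, s)" by (rule prod.exhaust)
        then have "i < m" "s \<in> shrikhande_connection" "w = (x(i := x i + s), u)"
          using 1 by (simp_all add: I_def f_def)
        then show ?thesis
          using x u by (auto simp: v_eq D_verts_def PiE_iff extensional_def D_adj_def shrikhande_adj_def)
      next
        case 2
        obtain j a where "p = (j, a)" by (rule prod.exhaust)
        then have "j < n" "a \<noteq> u j" "w = (x, u(j := a))"
          using 2 by (simp_all add: J_def g_def)
        then show ?thesis
          using x u by (auto simp: v_eq D_verts_def PiE_iff extensional_def D_adj_def K4_adj_def)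
      qed
    qed
  qed
  then have N: "{w \<in> D_verts m n. D_adj m n v w \<and> P w} = {w \<in> f ` I \<union> g ` J. P w}"
    by blast
  have fin: "finite I" "finite J"
    by (simp_all add: I_def J_def fin_conn)
  have inj_f: "inj_on f I"
  proof (rule inj_onI)
    fix p q assume pq: "p \<in> I" "q \<in> I" "f p = f q"
    obtain i s j t where eqs: "p = (i, s)" "q = (j, t)" by (metis surj_pair)
    then have st: "s \<noteq> (0,0)" and "x(i := x i + s) = x(j := x j + t)"
      using pq nz by (auto simp: I_def f_def)
    \<comment> \<open>At \<open>i\<close> the left side differs from \<open>x i\<close>, which
      forces \<open>j = i\<close>.\<close>
    then have "(x(i := x i + s)) i = (x(j := x j + t)) i" by simp
    then show "p = q"
      using st by (auto simp: eqs zero_prod_def[symmetric] split: if_splits)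
  qed
  have inj_g: "inj_on g J"
  proof (rule inj_onI)
    fix p q assume pq: "p \<in> J" "q \<in> J" "g p = g q"
    obtain i s j t where eqs: "p = (i, s)" "q = (j, t)" by (metis surj_pair)
    then have st: "s \<noteq> u i" and "u(i := s) = u(j := t)"
      using pq by (auto simp: J_def g_def)
    then have "(u(i := s)) i = (u(j := t)) i" by simp
    then show "p = q"
      using st by (auto simp: eqs split: if_splits)
  qed
  have disj: "f ` I \<inter> g ` J = {}"
  proof -
    have "f p \<noteq> g q" if "q \<in> J" for p q
    proof
      assume "f p = g q"
      moreover obtain i s j a where "p = (i, s)" "q = (j, a)" by (metis surj_pair)
      ultimately have "u j = (u(j := a)) j" "(j, a) \<in> J" using that by (simp_all add: f_def g_def)
      then show False by (simp add: J_def)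
    qed
    then show ?thesis by blast
  qed
  have "{w \<in> f ` I \<union> g ` J. P w} = (f ` I \<union> g ` J) \<inter> {w. P w}"
    by blast
  then have "int (card {w \<in> f ` I \<union> g ` J. P w}) = (\<Sum>w\<in>f ` I \<union> g ` J. of_bool (P w))"
    using fin by (simp only: sum_of_bool_eq finite_UnI finite_imageI)
  also have "\<dots> = (\<Sum>w\<in>f ` I. of_bool (P w)) + (\<Sum>w\<in>g ` J. of_bool (P w))"
    using fin disj by (intro sum.union_disjoint) auto
  also have "(\<Sum>w\<in>f ` I. of_bool (P w)) = (\<Sum>i<m. \<Sum>s\<in>shrikhande_connection. of_bool (P (f (i, s))) :: int)"
    by (subst sum.reindex[OF inj_f])
      (simp add: I_def sum.cartesian_product case_prod_beta' del: sum_of_bool_eq)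
  also have "(\<Sum>w\<in>g ` J. of_bool (P w)) = (\<Sum>j<n. \<Sum>a\<in>-{u j}. of_bool (P (g (j, a))) :: int)"
    by (subst sum.reindex[OF inj_g])
      (simp add: J_def sum.Sigma case_prod_beta' del: sum_of_bool_eq)
  finally show ?thesis
    unfolding N by (simp add: nbsum_def v_eq f_def g_def shrikhande_sum_def del: sum_of_bool_eq)
qed

lemma nbsum_cong:
  assumes "\<And>i p. i < m \<Longrightarrow> F (x(i := p), u) = G (x(i := p), u)"
    and "\<And>j a. j < n \<Longrightarrow> F (x, u(j := a)) = G (x, u(j := a))"
  shows "nbsum m n F (x, u) = nbsum m n G (x, u)"
  unfolding nbsum_def shrikhande_sum_def prod.case
  by (rule arg_cong2[where f = "(+)"]; intro sum.cong refl) (simp_all add: assms)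

lemma nbsum_Suc_left:
  "nbsum (Suc m) n F (x, u) = nbsum m n F (x, u) + shrikhande_sum (\<lambda>p. F (x(m := p), u)) (x m)"
  by (simp add: nbsum_def)

lemma nbsum_Suc_right:
  "nbsum m (Suc n) F (x, u) = nbsum m n F (x, u) + (\<Sum>a\<in>-{u n}. F (x, u(n := a)))"
  by (simp add: nbsum_def)

lemma nbsum_add_right:
  "nbsum m (n + N) F (x, u) = nbsum m n F (x, u) + (\<Sum>j<N. \<Sum>a\<in>-{u (n + j)}. F (x, u(n + j := a)))"
proof (induction N)
  case (Suc N)
  then show ?case
    by (simp only: add_Suc_right nbsum_Suc_right sum.lessThan_Suc add.assoc)
qed simp

text \<open>This takes the place of restricting the domain to \<open>D_verts m n\<close>: updating a
  later coordinate leaves the value of \<open>H\<close> unchanged.\<close>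

definition depends_on :: "nat \<Rightarrow> nat \<Rightarrow> (D_vertex \<Rightarrow> 'a) \<Rightarrow> bool" where
  "depends_on m n H \<longleftrightarrow> (\<forall>x u y t. (\<forall>i<m. x i = y i) \<longrightarrow> (\<forall>j<n. u j = t j) \<longrightarrow> H (x, u) = H (y, t))"

lemma depends_onD:
  "depends_on m n H \<Longrightarrow> (\<And>i. i < m \<Longrightarrow> x i = y i) \<Longrightarrow> (\<And>j. j < n \<Longrightarrow> u j = t j) \<Longrightarrow> H (x, u) = H (y, t)"
  unfolding depends_on_def by blast

lemma depends_on_mono: "depends_on m n H \<Longrightarrow> m \<le> m' \<Longrightarrow> n \<le> n' \<Longrightarrow> depends_on m' n' H"
  unfolding depends_on_def[of m'] by (intro allI impI) (rule depends_onD[of m n H], auto)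

subsection \<open>Blocks\<close>

text \<open>The coordinate \<open>i\<close> of \<open>H\<close> is the colour of the block \<open>i\<close> in \<open>K\<^sub>4\<^sub>,\<^sub>4\<^sub>,\<^sub>4\<^sub>,\<^sub>4\<close>, whose part is the
  first component.\<close>

definition block_system :: "nat \<Rightarrow> nat \<Rightarrow> nat \<Rightarrow> (D_vertex \<Rightarrow> nat \<Rightarrow> z4 \<times> v4) \<Rightarrow> bool" where
  "block_system m n N H \<longleftrightarrow> depends_on m n H \<and>
     (\<forall>F v. nbsum m n (\<lambda>w. F (H w)) v =
        (\<Sum>i<N. \<Sum>a\<in>-{fst (H v i)}. \<Sum>l\<in>UNIV. F ((H v)(i := (a, l)))))"

text \<open>The assumption \<open>split\<close> says that the old coordinates leave the colour
  \<open>h\<close> of the new block fixed, while the new coordinates fix \<open>H\<close> and see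
  through \<open>h\<close> each colour of the other parts once.\<close>

lemma block_system_extend:
  assumes H: "block_system m n N H" and le: "m \<le> m'" "n \<le> n'" and h: "depends_on m' n' h"
    and split: "\<And>F x u. nbsum m' n' (\<lambda>w. F (H w) (h w)) (x, u) =
       nbsum m n (\<lambda>w. F (H w) (h (x, u))) (x, u) +
       (\<Sum>a\<in>-{fst (h (x, u))}. \<Sum>l\<in>UNIV. F (H (x, u)) (a, l))"
  shows "block_system m' n' (Suc N) (\<lambda>w. (H w)(N := h w))"
  unfolding block_system_def
proof (intro conjI allI)
  have "depends_on m' n' H"
    using H le depends_on_mono unfolding block_system_def by blast
  then have "(H (x, u))(N := h (x, u)) = (H (y, t))(N := h (y, t))"
    if "\<forall>i<m'. x i = y i" "\<forall>j<n'. u j = t j" for x y u t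
    using that depends_onD[of m' n' H x y u t] depends_onD[OF h, of x y u t] by simp
  then show "depends_on m' n' (\<lambda>w. (H w)(N := h w))"
    unfolding depends_on_def by blast
next
  fix F :: "(nat \<Rightarrow> z4 \<times> v4) \<Rightarrow> int" and v :: D_vertex
  obtain x u where v: "v = (x, u)" by fastforce
  have "nbsum m n (\<lambda>w. F ((H w)(N := h v))) v =
    (\<Sum>i<N. \<Sum>a\<in>-{fst (H v i)}. \<Sum>l\<in>UNIV. F ((H v)(i := (a, l), N := h v)))"
    using H[unfolded block_system_def, THEN conjunct2, rule_format, of "\<lambda>g. F (g(N := h v))" v] .
  also have "\<dots> = (\<Sum>i<N. \<Sum>a\<in>-{fst (((H v)(N := h v)) i)}. \<Sum>l\<in>UNIV. F ((H v)(N := h v, i := (a, l))))"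
    by (intro sum.cong) (auto simp: fun_upd_twist)
  finally show "nbsum m' n' (\<lambda>w. F ((H w)(N := h w))) v = (\<Sum>i<Suc N.
      \<Sum>a\<in>-{fst (((H v)(N := h v)) i)}. \<Sum>l\<in>UNIV. F ((H v)(N := h v, i := (a, l))))"
    using split[of "\<lambda>p q. F (p(N := q))" x u] by (simp add: v)
qed

lemma K4_sum: "(\<Sum>a\<in>-{c :: z4}. f a) = f (c + 1) + f (c + 2) + f (c + 3)"
proof -
  have "(\<Sum>a\<in>-{c}. f a) = (\<Sum>s\<in>-{0}. f (c + s))"
    by (rule sum_translate_nonzero[symmetric])
  then show ?thesis by (simp add: Compl_z4 add_ac)
qed

text \<open>The free base point \<open>c\<close> allows the terms to be matched with those of a sum
  over neighbours.\<close>

lemma UNIV_z4_sum: "(\<Sum>a\<in>UNIV. f (a :: z4)) = f c + f (c + 1) + f (c + 2) + f (c + 3)"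
proof -
  have "(\<Sum>a\<in>UNIV. f a) = (\<Sum>t\<in>UNIV. f (c + t))"
    by (rule sum_translate[symmetric])
  then show ?thesis by (simp only: UNIV_z4) (simp add: add_ac)
qed

text \<open>By \<open>sum_lines\<close> with the four lines in \<open>v4\<close>, changing one of
  the four new coordinates reaches every pair of sums with a new first component exactly
  once.\<close>

lemma block_system_K4s:
  assumes H: "block_system m n N H"
  shows "\<exists>H. block_system m (n + 4) (Suc N) H"
proof -
  obtain A :: "nat \<Rightarrow> v4 \<Rightarrow> v4" where A: "\<And>j s t. A j (s + t) = A j s + A j t"
    "\<And>s. s \<noteq> 0 \<Longrightarrow> bij_betw (\<lambda>j. A j s) {..<4} UNIV"
    using lines_v4 by blast
  define h :: "D_vertex \<Rightarrow> z4 \<times> v4" where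
    "h = (\<lambda>(x, u). (dec (\<Sum>i<4. enc (u (n + i))), \<Sum>i<4. A i (enc (u (n + i)))))"
  have H_dep: "depends_on m n H"
    using H by (simp add: block_system_def)
  have "block_system m (n + 4) (Suc N) (\<lambda>w. (H w)(N := h w))"
  proof (rule block_system_extend[OF H])
    show "depends_on m (n + 4) h"
      unfolding depends_on_def h_def by (auto intro!: sum.cong arg_cong[where f = dec])
  next
    fix F :: "(nat \<Rightarrow> z4 \<times> v4) \<Rightarrow> z4 \<times> v4 \<Rightarrow> int" and x :: "nat \<Rightarrow> z4 \<times> z4" and u :: "nat \<Rightarrow> z4"
    define w where "w = (\<lambda>i. u (n + i))"
    have upd: "(u(n + j := a)) (n + i) = (w(j := a)) i" for i j a
      by (simp add: w_def)
    have H_eq: "H (x, u(n + j := a)) = H (x, u)" for j a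
      by (rule depends_onD[OF H_dep]) auto
    have "(\<Sum>j<4. \<Sum>a\<in>-{u (n + j)}. F (H (x, u(n + j := a))) (h (x, u(n + j := a)))) =
      (\<Sum>j<4. \<Sum>a\<in>-{w j}. F (H (x, u)) (dec (\<Sum>i<4. enc ((w(j := a)) i)), \<Sum>i<4. A i (enc ((w(j := a)) i))))"
      unfolding H_eq h_def prod.case upd by (simp add: w_def)
    also have "\<dots> = (\<Sum>s\<in>-{\<Sum>i<4. enc (w i)}. \<Sum>t\<in>UNIV. F (H (x, u)) (dec s, t))"
      by (rule sum_lines[OF A, where F = "\<lambda>s t. F (H (x, u)) (dec s, t)"])
    also have "\<dots> = (\<Sum>a\<in>-{fst (h (x, u))}. \<Sum>l\<in>UNIV. F (H (x, u)) (a, l))"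
      by (rule sum.reindex_bij_witness[where i = enc and j = dec])
        (auto simp: h_def w_def dec_eq_iff enc_eq_iff)
    finally have "nbsum m (n + 4) (\<lambda>w. F (H w) (h w)) (x, u) = nbsum m n (\<lambda>w. F (H w) (h w)) (x, u) +
        (\<Sum>a\<in>-{fst (h (x, u))}. \<Sum>l\<in>UNIV. F (H (x, u)) (a, l))"
      by (simp add: nbsum_add_right)
    \<comment> \<open>\<open>h\<close> reads \<open>u\<close> only from position \<open>n\<close>
      on, so it is constant under the updates counted here.\<close>
    also have "nbsum m n (\<lambda>w. F (H w) (h w)) (x, u) = nbsum m n (\<lambda>w. F (H w) (h (x, u))) (x, u)"
      by (rule nbsum_cong) (auto simp: h_def)
    finally show "nbsum m (n + 4) (\<lambda>w. F (H w) (h w)) (x, u) =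
       nbsum m n (\<lambda>w. F (H w) (h (x, u))) (x, u) +
       (\<Sum>a\<in>-{fst (h (x, u))}. \<Sum>l\<in>UNIV. F (H (x, u)) (a, l))" .
  qed auto
  then show ?thesis by blast
qed

lemma mult_z4:
  "2 * (x + 1 :: z4) = 2 * x + 2" "2 * (x + 2 :: z4) = 2 * x" "2 * (x + 3 :: z4) = 2 * x + 2"
  "3 * (x + 1 :: z4) = 3 * x + 3" "3 * (x + 2 :: z4) = 3 * x + 2" "3 * (x + 3 :: z4) = 3 * x + 1"
proof -
  have "(4 :: z4) = 0" "(6 :: z4) = 2" "(9 :: z4) = 1" by simp_all
  then show "2 * (x + 1 :: z4) = 2 * x + 2" "2 * (x + 2 :: z4) = 2 * x" "2 * (x + 3 :: z4) = 2 * x + 2"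
    "3 * (x + 1 :: z4) = 3 * x + 3" "3 * (x + 2 :: z4) = 3 * x + 2" "3 * (x + 3 :: z4) = 3 * x + 1"
    by (simp_all add: distrib_left)
qed

lemma add_z4: "1 + (1 + x :: z4) = 2 + x" "3 + 3 = (2 :: z4)"
  by (simp_all add: add.assoc[symmetric])

text \<open>With \<open>K\<^sub>4\<close> regarded as a Cayley graph on \<open>Z\<^sub>4\<close>, the homomorphism to \<open>Z\<^sub>4\<^sup>2\<close> given by the
  columns \<open>(1, 0), (1, 1), (1, 2), (1, 3)\<close> sends the connection set bijectively to the elements
  outside \<open>{0} \<times> Z\<^sub>4\<close>.\<close>

lemma shrikhande_K4_K4_sum:
  fixes G :: "z4 \<Rightarrow> z4 \<Rightarrow> int"
  shows "shrikhande_sum (\<lambda>p. G (fst p + snd p + c + d) (snd p + 2 * c + 3 * d)) p +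
    (\<Sum>a\<in>-{c}. G (fst p + snd p + a + d) (snd p + 2 * a + 3 * d)) +
    (\<Sum>a\<in>-{d}. G (fst p + snd p + c + a) (snd p + 2 * c + 3 * a)) =
    (\<Sum>a\<in>-{fst p + snd p + c + d}. \<Sum>l\<in>UNIV. G a l)"
proof -
  obtain y z where p: "p = (y, z)" by fastforce
  show ?thesis
    \<comment> \<open>Both sides become sums of the same 12 values, 6 + 3 + 3 on the left and 3
      times 4 on the right.\<close>
    unfolding K4_sum UNIV_z4_sum[of _ "z + 2 * c + 3 * d"] p shrikhande_sum_expand fst_conv snd_conv mult_z4
    by (simp only: add_ac) (simp only: add_z4 add_ac)
qed

text \<open>The homomorphism of \<open>shrikhande_K4_K4_sum\<close> is applied to the new
  coordinates; \<open>enc\<close> only renames the four colours inside a part.\<close>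

lemma block_system_shrikhande_K4s:
  assumes H: "block_system m n N H"
  shows "\<exists>H. block_system (Suc m) (n + 2) (Suc N) H"
proof -
  define h :: "D_vertex \<Rightarrow> z4 \<times> v4" where
    "h = (\<lambda>(x, u). (fst (x m) + snd (x m) + u n + u (Suc n), enc (snd (x m) + 2 * u n + 3 * u (Suc n))))"
  have H_dep: "depends_on m n H"
    using H by (simp add: block_system_def)
  have "block_system (Suc m) (Suc (Suc n)) (Suc N) (\<lambda>w. (H w)(N := h w))"
  proof (rule block_system_extend[OF H])
    show "depends_on (Suc m) (Suc (Suc n)) h"
      unfolding depends_on_def h_def by auto
  next
    fix F :: "(nat \<Rightarrow> z4 \<times> v4) \<Rightarrow> z4 \<times> v4 \<Rightarrow> int" and x :: "nat \<Rightarrow> z4 \<times> z4" and u :: "nat \<Rightarrow> z4"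
    have H_eq: "H (x(m := p), u) = H (x, u)" "H (x, u(n := a)) = H (x, u)"
      "H (x, u(Suc n := a)) = H (x, u)" for p a
      by (rule depends_onD[OF H_dep]; simp)+
    have h_eq: "nbsum m n (\<lambda>w. F (H w) (h w)) (x, u) = nbsum m n (\<lambda>w. F (H w) (h (x, u))) (x, u)"
      by (rule nbsum_cong) (auto simp: h_def)
    have enc: "(\<Sum>l\<in>UNIV. F (H (x, u)) (a, enc l)) = (\<Sum>l\<in>UNIV. F (H (x, u)) (a, l))" for a
      using sum.reindex_bij_betw[OF bij_enc, of "\<lambda>l. F (H (x, u)) (a, l)"] .
    show "nbsum (Suc m) (Suc (Suc n)) (\<lambda>w. F (H w) (h w)) (x, u) =
       nbsum m n (\<lambda>w. F (H w) (h (x, u))) (x, u) +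
       (\<Sum>a\<in>-{fst (h (x, u))}. \<Sum>l\<in>UNIV. F (H (x, u)) (a, l))"
      using shrikhande_K4_K4_sum[of "\<lambda>a l. F (H (x, u)) (a, enc l)" "u n" "u (Suc n)" "x m"]
      unfolding nbsum_Suc_left nbsum_Suc_right H_eq h_eq enc
      by (simp add: h_def add.assoc)
  qed auto
  then show ?thesis by auto
qed

text \<open>For this block the colours are the elements of \<open>Z\<^sub>4\<^sup>2\<close>, and the parts are the cosets of
  the subgroup \<open>2 Z\<^sub>4\<^sup>2\<close>: the two images of the connection set partition the elements of order 4.\<close>

definition parity_split :: "z4 \<times> z4 \<Rightarrow> z4 \<times> v4" where
  "parity_split q = (dec (fst (enc (fst q)), fst (enc (snd q))), (snd (enc (fst q)), snd (enc (snd q))))"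

lemma bij_parity_split: "bij parity_split"
proof (rule o_bij)
  define E where "E = (\<lambda>(a, l). (dec (fst (enc a), fst l), dec (snd (enc a), snd l)))"
  show "E \<circ> parity_split = id" "parity_split \<circ> E = id"
    by (auto simp: E_def parity_split_def)
qed

lemma fst_parity_split_eq_iff:
  "fst (parity_split p) = fst (parity_split q) \<longleftrightarrow> p - q \<in> {0, 2} \<times> {0, 2}"
proof -
  have "\<forall>x y :: z4. fst (enc x) = fst (enc y) \<longleftrightarrow> x - y \<in> {0, 2}"
    unfolding all_z4 by (simp add: enc_def)
  then show ?thesis
    by (cases p; cases q) (simp only: parity_split_def dec_eq_iff fst_conv snd_conv prod.inject mem_Times_iff diff_Pair)
qed

text \<open>Translation by the elements outside the subgroup reaches every element of the other
  cosets once, and \<open>parity_split\<close> maps these bijectively to the colours of the other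
  parts.\<close>

lemma parity_split_sum:
  fixes G :: "z4 \<times> v4 \<Rightarrow> int"
  shows "(\<Sum>s\<in>-({0, 2} \<times> {0, 2}). G (parity_split (q + s))) =
    (\<Sum>a\<in>-{fst (parity_split q)}. \<Sum>l\<in>UNIV. G (a, l))"
proof -
  have "(\<Sum>s\<in>-({0, 2} \<times> {0, 2}). G (parity_split (q + s))) =
    (\<Sum>p | fst (parity_split p) \<noteq> fst (parity_split q). G (parity_split p))"
    by (rule sum.reindex_bij_witness[where i = "\<lambda>p. p - q" and j = "\<lambda>s. q + s"])
      (simp_all add: fst_parity_split_eq_iff)
  also have "\<dots> = (\<Sum>y | fst y \<noteq> fst (parity_split q). G y)"
  proof (rule sum.reindex_bij_betw, rule bij_betw_subset[OF bij_parity_split subset_UNIV])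
    show "parity_split ` {p. fst (parity_split p) \<noteq> fst (parity_split q)} =
      {y. fst y \<noteq> fst (parity_split q)}"
      using surj_image_vimage_eq[OF bij_is_surj[OF bij_parity_split],
          of "{y. fst y \<noteq> fst (parity_split q)}"]
      by (simp add: vimage_def)
  qed
  also have "{y :: z4 \<times> v4. fst y \<noteq> fst (parity_split q)} = (-{fst (parity_split q)}) \<times> UNIV"
    by auto
  also have "(\<Sum>y\<in>\<dots>. G y) = (\<Sum>a\<in>-{fst (parity_split q)}. \<Sum>l\<in>UNIV. G (a, l))"
    by (simp add: sum.cartesian_product)
  finally show ?thesis .
qed

text \<open>The first six terms belong to the connection set, the last six to its image under
  \<open>(a, b) \<mapsto> (a + 2 * b, 2 * a + 3 * b)\<close>, in the same order.\<close>

lemma odd_pairs_sum: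
  fixes f :: "z4 \<times> z4 \<Rightarrow> int"
  shows "(\<Sum>s\<in>-({0, 2} \<times> {0, 2}). f s) =
    f (0, 1) + f (0, 3) + f (1, 0) + f (3, 0) + f (1, 1) + f (3, 3) +
    (f (2, 3) + f (2, 1) + f (1, 2) + f (3, 2) + f (3, 1) + f (1, 3))"
proof -
  have "-({0, 2} \<times> {0, 2}) = {(0, 1), (0, 3), (1, 0), (3, 0), (1, 1), (3, 3),
    (2, 3), (2, 1), (1, 2), (3, 2), (3, 1), (1 :: z4, 3 :: z4)}"
    unfolding set_eq_iff split_paired_All all_z4 by simp
  then show ?thesis by simp
qed

text \<open>\<open>q p r\<close> is \<open>p\<close> plus the image of \<open>r\<close> under the
  linear map of \<open>odd_pairs_sum\<close>; steps in \<open>p\<close> and in \<open>r\<close> thus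
  supply the two halves of that sum.\<close>

lemma block_system_shrikhandes:
  assumes H: "block_system m n N H"
  shows "\<exists>H. block_system (m + 2) n (Suc N) H"
proof -
  define q where "q p r = (fst p + fst r + 2 * snd r, snd p + 2 * fst r + 3 * snd r)" for p r :: "z4 \<times> z4"
  define h :: "D_vertex \<Rightarrow> z4 \<times> v4" where "h = (\<lambda>(x, u). parity_split (q (x m) (x (Suc m))))"
  have H_dep: "depends_on m n H"
    using H by (simp add: block_system_def)
  have q_sum: "shrikhande_sum (\<lambda>p. G (parity_split (q p r))) p + shrikhande_sum (\<lambda>r. G (parity_split (q p r))) r =
    (\<Sum>a\<in>-{fst (parity_split (q p r))}. \<Sum>l\<in>UNIV. G (a, l))" for G :: "z4 \<times> v4 \<Rightarrow> int" and p r
  proof -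
    have "q (p + d) r = q p r + d"
      "q p (r + d) = q p r + (fst d + 2 * snd d, 2 * fst d + 3 * snd d)" for d
      by (simp_all add: q_def prod_eq_iff distrib_left add_ac)
    moreover have num: "(5 :: z4) = 1" "(6 :: z4) = 2" "(9 :: z4) = 1" "(15 :: z4) = 3"
      by simp_all
    ultimately show ?thesis
      unfolding parity_split_sum[symmetric] odd_pairs_sum shrikhande_sum_def
      by (simp add: shrikhande_connection_def num)
  qed
  have "block_system (Suc (Suc m)) n (Suc N) (\<lambda>w. (H w)(N := h w))"
  proof (rule block_system_extend[OF H])
    show "depends_on (Suc (Suc m)) n h"
      unfolding depends_on_def h_def by auto
  next
    fix F :: "(nat \<Rightarrow> z4 \<times> v4) \<Rightarrow> z4 \<times> v4 \<Rightarrow> int" and x :: "nat \<Rightarrow> z4 \<times> z4" and u :: "nat \<Rightarrow> z4"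
    have H_eq: "H (x(m := p), u) = H (x, u)" "H (x(Suc m := p), u) = H (x, u)" for p
      by (rule depends_onD[OF H_dep]; simp)+
    have h_eq: "nbsum m n (\<lambda>w. F (H w) (h w)) (x, u) = nbsum m n (\<lambda>w. F (H w) (h (x, u))) (x, u)"
      by (rule nbsum_cong) (auto simp: h_def)
    show "nbsum (Suc (Suc m)) n (\<lambda>w. F (H w) (h w)) (x, u) =
       nbsum m n (\<lambda>w. F (H w) (h (x, u))) (x, u) +
       (\<Sum>a\<in>-{fst (h (x, u))}. \<Sum>l\<in>UNIV. F (H (x, u)) (a, l))"
      using q_sum[of "F (H (x, u))" "x (Suc m)" "x m"]
      unfolding nbsum_Suc_left H_eq h_eq by (simp add: h_def)
  qed auto
  then show ?thesis by auto
qed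

text \<open>Each block uses up 4 units of \<open>2 * m + n\<close>. Shrikhande factors are taken in
  pairs, a single remaining one is combined with two \<open>K4\<close>, and the rest consists of
  blocks of four \<open>K4\<close>.\<close>

lemma exists_block_system:
  assumes "2 * m + n = 4 * N"
  shows "\<exists>H. block_system m n N H"
  using assms
proof (induction N arbitrary: m n)
  case 0
  then show ?case
    by (intro exI[of _ "\<lambda>_ _. undefined"]) (simp add: block_system_def depends_on_def nbsum_def split_paired_All)
next
  case (Suc N)
  consider "m \<ge> 2" | "m = 1" | "m = 0" by linarith
  then show ?case
  proof cases
    case 1
    then have "2 * (m - 2) + n = 4 * N" using Suc.prems by simp
    then show ?thesis using Suc.IH block_system_shrikhandes[of "m - 2" n N] 1 by (metis le_add_diff_inverse2)
  next
    case 2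
    then have "n \<ge> 2" "2 * 0 + (n - 2) = 4 * N" using Suc.prems by simp_all
    then show ?thesis using Suc.IH[of 0 "n - 2"] block_system_shrikhande_K4s[of 0 "n - 2" N] 2
      by (metis One_nat_def le_add_diff_inverse2)
  next
    case 3
    then have "n \<ge> 4" "2 * 0 + (n - 4) = 4 * N" using Suc.prems by simp_all
    then show ?thesis using Suc.IH[of 0 "n - 4"] block_system_K4s[of 0 "n - 4" N] 3
      by (metis le_add_diff_inverse2)
  qed
qed

subsection \<open>The equitable map onto a complete multipartite graph\<close>

text \<open>Lists of length \<open>k\<close> name the \<open>4 ^ k\<close> parts, which lets the
  number of parts vary in an induction; \<theta> is the position inside a part.\<close>

definition multipartite :: "nat \<Rightarrow> nat \<Rightarrow> nat \<Rightarrow> (D_vertex \<Rightarrow> v4 list) \<Rightarrow> (D_vertex \<Rightarrow> v8) \<Rightarrow> bool" where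
  "multipartite m n k z \<theta> \<longleftrightarrow> depends_on m n z \<and> depends_on m n \<theta> \<and> (\<forall>v. length (z v) = k) \<and>
     (\<forall>F v. nbsum m n (\<lambda>w. F (z w) (\<theta> w)) v =
        (\<Sum>p\<in>{p. length p = k} - {z v}. \<Sum>t\<in>UNIV. F p t))"

lemma finite_v4_lists: "finite {p :: v4 list. length p = k}"
  using finite_lists_length_eq[of "UNIV :: v4 set" k] by simp

text \<open>A list other than \<open>l # p\<close> has either another tail and any head, or the tail
  \<open>p\<close> and another head.\<close>

lemma sum_lists_Suc:
  fixes f :: "v4 list \<Rightarrow> int"
  assumes "length p = k"
  shows "(\<Sum>q\<in>{q. length q = Suc k} - {l # p}. f q) =
    (\<Sum>q\<in>{q. length q = k} - {p}. \<Sum>i\<in>UNIV. f (i # q)) + (\<Sum>i\<in>-{l}. f (i # p))"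
proof -
  have "(\<Sum>q\<in>{q. length q = Suc k}. f q) = (\<Sum>(q, i)\<in>{q. length q = k} \<times> UNIV. f (i # q))"
    by (rule sum.reindex_bij_witness[where i = "\<lambda>(q, i). i # q" and j = "\<lambda>q. (tl q, hd q)"])
      (auto simp: length_Suc_conv)
  also have "\<dots> = (\<Sum>q\<in>{q. length q = k}. \<Sum>i\<in>UNIV. f (i # q))"
    by (simp add: sum.cartesian_product)
  also have "\<dots> = (\<Sum>i\<in>UNIV. f (i # p)) + (\<Sum>q\<in>{q. length q = k} - {p}. \<Sum>i\<in>UNIV. f (i # q))"
    using assms by (intro sum.remove finite_v4_lists) simp
  also have "(\<Sum>i\<in>UNIV. f (i # p)) = f (l # p) + (\<Sum>i\<in>-{l}. f (i # p))"
    by (simp add: Compl_eq_Diff_UNIV sum.remove)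
  finally show ?thesis
    using assms by (simp add: sum_diff1 finite_v4_lists)
qed

lemma sum_translate_Compl:
  fixes c :: "'a::ab_group_add"
  shows "(\<Sum>s\<in>-{c}. f (d + s)) = (\<Sum>s\<in>-{d + c}. f s)"
  by (rule sum.reindex_bij_witness[where i = "\<lambda>t. t - d" and j = "\<lambda>t. d + t"]) auto

text \<open>The parts of the blocks form a vertex of the old Hamming graph, hence a list
  \<open>zb\<close> and a position \<open>tb\<close>; the sum \<open>L\<close> of the labels takes
  every value once when one block changes. This gives parts of size 32. The 8 new coordinates move
  the pair (\<open>L + U\<close>, \<open>tb + T\<close>) along lines, so the first entry can be
  split off as the new head.\<close>

lemma multipartite_step:
  assumes old: "multipartite 0 N k z\<^sub>0 \<theta>\<^sub>0" and H: "block_system m n N H"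
  shows "\<exists>z \<theta>. multipartite m (n + 8) (Suc k) z \<theta>"
proof -
  obtain A :: "nat \<Rightarrow> v4 \<Rightarrow> v8" where A: "\<And>j s t. A j (s + t) = A j s + A j t"
    "\<And>s. s \<noteq> 0 \<Longrightarrow> bij_betw (\<lambda>j. A j s) {..<8} UNIV"
    using lines_v8 by blast
  have H_dep: "depends_on m n H"
    and H_sum: "\<And>F v. nbsum m n (\<lambda>w. F (H w)) v =
        (\<Sum>i<N. \<Sum>a\<in>-{fst (H v i)}. \<Sum>l\<in>UNIV. F ((H v)(i := (a, l))))"
    using H unfolding block_system_def by blast+
  have z_len: "\<And>v. length (z\<^sub>0 v) = k"
    and z_sum: "\<And>F v. nbsum 0 N (\<lambda>w. F (z\<^sub>0 w) (\<theta>\<^sub>0 w)) v =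
        (\<Sum>p\<in>{p. length p = k} - {z\<^sub>0 v}. \<Sum>t\<in>UNIV. F p t)"
    using old unfolding multipartite_def by blast+
  define L where "L g = (\<Sum>i<N. snd (g i))" for g :: "nat \<Rightarrow> z4 \<times> v4"
  \<comment> \<open>The old graph has no Shrikhande factor; the constant \<open>0\<close> fills that
    slot.\<close>
  define zb where "zb g = z\<^sub>0 (\<lambda>_. 0, fst \<circ> g)" for g :: "nat \<Rightarrow> z4 \<times> v4"
  define tb where "tb g = \<theta>\<^sub>0 (\<lambda>_. 0, fst \<circ> g)" for g :: "nat \<Rightarrow> z4 \<times> v4"
  define U where "U w = (\<Sum>j<8. enc (w j))" for w :: "nat \<Rightarrow> z4"
  define T where "T w = (\<Sum>j<8. A j (enc (w j)))" for w :: "nat \<Rightarrow> z4"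
  define z where "z = (\<lambda>(x, u). (L (H (x, u)) + U (\<lambda>j. u (n + j))) # zb (H (x, u)))"
  define \<theta> where "\<theta> = (\<lambda>(x, u). tb (H (x, u)) + T (\<lambda>j. u (n + j)))"
  have dep: "H (x, u) = H (y, t) \<and> U (\<lambda>j. u (n + j)) = U (\<lambda>j. t (n + j)) \<and>
      T (\<lambda>j. u (n + j)) = T (\<lambda>j. t (n + j))"
    if "\<forall>i<m. x i = y i" "\<forall>j<n + 8. u j = t j" for x y u t
    using that by (auto simp: U_def T_def intro!: depends_onD[OF H_dep] sum.cong)
  have "z (x, u) = z (y, t) \<and> \<theta> (x, u) = \<theta> (y, t)"
    if "\<forall>i<m. x i = y i" "\<forall>j<n + 8. u j = t j" for x y u t
    using dep[OF that] by (simp add: z_def \<theta>_def)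
  then have "depends_on m (n + 8) z" "depends_on m (n + 8) \<theta>"
    unfolding depends_on_def by blast+
  moreover have "length (z v) = Suc k" for v
    by (simp add: z_def zb_def z_len split: prod.split)
  moreover have "nbsum m (n + 8) (\<lambda>w. F (z w) (\<theta> w)) v =
    (\<Sum>p\<in>{p. length p = Suc k} - {z v}. \<Sum>t\<in>UNIV. F p t)" for F :: "v4 list \<Rightarrow> v8 \<Rightarrow> int" and v
  proof -
    obtain x u where v: "v = (x, u)" by fastforce
    define g where "g = H (x, u)"
    define w where "w = (\<lambda>j. u (n + j))"
    have upd: "(\<lambda>i. (u(n + j := a)) (n + i)) = w(j := a)" for j a
      by (auto simp: w_def)
    have H_eq: "H (x, u(n + j := a)) = g" for j a
      unfolding g_def by (rule depends_onD[OF H_dep]) auto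
    define G where "G g' = F ((L g' + U w) # zb g') (tb g' + T w)" for g'
    define \<Phi> where "\<Phi> p t = (\<Sum>l\<in>UNIV. F (l # p) (t + T w))" for p t
    have G_sum: "(\<Sum>l\<in>UNIV. G (g(i := (a, l)))) =
      \<Phi> (z\<^sub>0 (\<lambda>_. 0, (fst \<circ> g)(i := a))) (\<theta>\<^sub>0 (\<lambda>_. 0, (fst \<circ> g)(i := a)))" if "i < N" for i a
    proof -
      have fst: "fst \<circ> g(i := (a, l)) = (fst \<circ> g)(i := a)" for l
        by auto
      \<comment> \<open>The head is a fixed translate of \<open>l\<close>, so summing over
        \<open>l\<close> yields every head once.\<close>
      have "L (g(i := (a, l))) + U w = (L g - snd (g i) + U w) + l" for l
        using sum_fun_upd[OF that, of "\<lambda>_. snd" g "(a, l)"] by (simp add: L_def algebra_simps)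
      then have "(\<Sum>l\<in>UNIV. G (g(i := (a, l)))) =
        (\<Sum>l\<in>UNIV. F (((L g - snd (g i) + U w) + l) # z\<^sub>0 (\<lambda>_. 0, (fst \<circ> g)(i := a)))
          (\<theta>\<^sub>0 (\<lambda>_. 0, (fst \<circ> g)(i := a)) + T w))"
        unfolding G_def zb_def tb_def fst by (simp only:)
      also have "\<dots> = \<Phi> (z\<^sub>0 (\<lambda>_. 0, (fst \<circ> g)(i := a))) (\<theta>\<^sub>0 (\<lambda>_. 0, (fst \<circ> g)(i := a)))"
        unfolding \<Phi>_def by (rule sum_translate)
      finally show ?thesis .
    qed
    have "nbsum m n (\<lambda>w. F (z w) (\<theta> w)) (x, u) = nbsum m n (\<lambda>w. G (H w)) (x, u)"
    proof (rule nbsum_cong)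
      fix j a assume "j < n"
      then have "(\<lambda>i. (u(j := a)) (n + i)) = w"
        by (auto simp: w_def)
      then show "F (z (x, u(j := a))) (\<theta> (x, u(j := a))) = G (H (x, u(j := a)))"
        by (simp only: z_def \<theta>_def G_def prod.case)
    qed (simp add: z_def \<theta>_def G_def w_def)
    also have "\<dots> = (\<Sum>i<N. \<Sum>a\<in>-{fst (g i)}. \<Sum>l\<in>UNIV. G (g(i := (a, l))))"
      unfolding g_def by (rule H_sum)
    also have "\<dots> = (\<Sum>i<N. \<Sum>a\<in>-{(fst \<circ> g) i}.
        \<Phi> (z\<^sub>0 (\<lambda>_. 0, (fst \<circ> g)(i := a))) (\<theta>\<^sub>0 (\<lambda>_. 0, (fst \<circ> g)(i := a))))"
      using G_sum by (intro sum.cong) auto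
    also have "\<dots> = nbsum 0 N (\<lambda>w. \<Phi> (z\<^sub>0 w) (\<theta>\<^sub>0 w)) (\<lambda>_. 0, fst \<circ> g)"
      by (simp add: nbsum_def)
    also have "\<dots> = (\<Sum>p\<in>{p. length p = k} - {zb g}. \<Sum>t\<in>UNIV. \<Phi> p t)"
      unfolding zb_def by (rule z_sum)
    also have "\<dots> = (\<Sum>p\<in>{p. length p = k} - {zb g}. \<Sum>l\<in>UNIV. \<Sum>t\<in>UNIV. F (l # p) t)"
    proof (rule sum.cong[OF refl])
      fix p
      have "(\<Sum>t\<in>UNIV. \<Phi> p t) = (\<Sum>l\<in>UNIV. \<Sum>t\<in>UNIV. F (l # p) (T w + t))"
        unfolding \<Phi>_def by (subst sum.swap) (simp only: add.commute)
      then show "(\<Sum>t\<in>UNIV. \<Phi> p t) = (\<Sum>l\<in>UNIV. \<Sum>t\<in>UNIV. F (l # p) t)"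
        by (simp only: sum_translate)
    qed
    finally have part1: "nbsum m n (\<lambda>w. F (z w) (\<theta> w)) (x, u) =
      (\<Sum>p\<in>{p. length p = k} - {zb g}. \<Sum>l\<in>UNIV. \<Sum>t\<in>UNIV. F (l # p) t)" .
    have "(\<Sum>j<8. \<Sum>a\<in>-{u (n + j)}. F (z (x, u(n + j := a))) (\<theta> (x, u(n + j := a)))) =
      (\<Sum>j<8. \<Sum>a\<in>-{w j}. F ((L g + (\<Sum>i<8. enc ((w(j := a)) i))) # zb g)
         (tb g + (\<Sum>i<8. A i (enc ((w(j := a)) i)))))"
      unfolding z_def \<theta>_def prod.case H_eq upd unfolding U_def T_def by (simp only: w_def)
    also have "\<dots> = (\<Sum>s\<in>-{U w}. \<Sum>t\<in>UNIV. F ((L g + s) # zb g) (tb g + t))"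
      unfolding U_def by (rule sum_lines[OF A, where F = "\<lambda>s t. F ((L g + s) # zb g) (tb g + t)"])
    also have "\<dots> = (\<Sum>l\<in>-{L g + U w}. \<Sum>t\<in>UNIV. F (l # zb g) t)"
      by (simp only: sum_translate sum_translate_Compl[where f = "\<lambda>l. \<Sum>t\<in>UNIV. F (l # zb g) t"])
    finally have part2: "(\<Sum>j<8. \<Sum>a\<in>-{u (n + j)}. F (z (x, u(n + j := a))) (\<theta> (x, u(n + j := a)))) =
      (\<Sum>l\<in>-{L g + U w}. \<Sum>t\<in>UNIV. F (l # zb g) t)" .
    have "z v = (L g + U w) # zb g"
      by (simp add: z_def v g_def w_def)
    moreover have "length (zb g) = k"
      by (simp add: zb_def z_len)
    ultimately show ?thesis
      unfolding v nbsum_add_right part1 part2 by (simp only: sum_lists_Suc)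
  qed
  ultimately show ?thesis
    unfolding multipartite_def by blast
qed

text \<open>The equation equates the degree \<open>6 * m + 3 * n\<close> with the number
  \<open>8 * (4 ^ k - 1)\<close> of colours outside one part.\<close>

lemma exists_multipartite:
  assumes "3 * (2 * m + n) + 8 = 8 * 4 ^ k" and "k \<ge> 1 \<Longrightarrow> n \<ge> 8"
  shows "\<exists>z \<theta>. multipartite m n k z \<theta>"
  using assms
proof (induction k arbitrary: m n)
  case 0
  have "multipartite m n 0 (\<lambda>_. []) (\<lambda>_. 0)"
    using 0 by (simp add: multipartite_def depends_on_def nbsum_def split_paired_All)
  then show ?case by blast
next
  case (Suc k)
  have "\<exists>r. (4 :: nat) ^ k = 3 * r + 1"
  proof (induction k)
    case (Suc k)
    then obtain r where "(4 :: nat) ^ k = 3 * r + 1" by blast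
    then have "4 ^ Suc k = 3 * (4 * r + 1) + (1 :: nat)" by simp
    then show ?case by blast
  qed simp
  then obtain r where r: "(4 :: nat) ^ k = 3 * r + 1" by blast
  \<comment> \<open>The smaller instance is the Hamming graph with \<open>8 * r\<close> coordinates,
    each of which is then replaced by a block.\<close>
  have N: "3 * (2 * 0 + 8 * r) + 8 = 8 * 4 ^ k"
    using r by simp
  have "8 * r \<ge> 8" if "k \<ge> 1"
  proof -
    have "(4 :: nat) ^ 1 \<le> 4 ^ k"
      using that by (intro power_increasing) auto
    then show ?thesis using r by simp
  qed
  then obtain z\<^sub>0 \<theta>\<^sub>0 where "multipartite 0 (8 * r) k z\<^sub>0 \<theta>\<^sub>0"
    using Suc.IH[OF N] by blast
  moreover have n: "n \<ge> 8" and "2 * m + (n - 8) = 4 * (8 * r)"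
    using Suc.prems r by auto
  then obtain H where "block_system m (n - 8) (8 * r) H"
    using exists_block_system by blast
  ultimately show ?case
    using multipartite_step n by (metis le_add_diff_inverse2)
qed

subsection \<open>Assembling the colouring\<close>

lemma exists_densities_two_special:
  fixes S :: "'a set"
  assumes "finite S" and x: "x \<in> S" "y \<in> S" "x \<noteq> y" and q: "q + 2 \<le> card S"
    and ab: "{a, b} \<subseteq> {0, 3, 4, 5, 8 :: int}"
  shows "\<exists>f. (\<forall>s. f s \<in> {0, 3, 4, 5, 8}) \<and> (\<Sum>s\<in>S. f s) = a + b + 8 * int q"
proof -
  have "q \<le> card (S - {x, y})"
    using assms by (simp add: card_Diff_subset)
  then obtain Q where Q: "Q \<subseteq> S - {x, y}" "card Q = q" "finite Q"
    by (rule obtain_subset_with_card_n)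
  define f where "f s = (if s = x then a else if s = y then b else if s \<in> Q then 8 else 0)" for s
  have "(\<Sum>s\<in>S. f s) = f x + (f y + (\<Sum>s\<in>S - {x} - {y}. f s))"
    using assms by (simp add: sum.remove[of S x] sum.remove[of "S - {x}" y])
  also have "(\<Sum>s\<in>S - {x} - {y}. f s) = (\<Sum>s\<in>Q. 8)"
    using Q assms by (intro sum.mono_neutral_cong_right) (auto simp: f_def)
  finally have "(\<Sum>s\<in>S. f s) = a + b + 8 * int q"
    using Q x by (simp add: f_def)
  moreover have "\<forall>s. f s \<in> {0, 3, 4, 5, 8}"
    using ab by (auto simp: f_def)
  ultimately show ?thesis by blast
qed

text \<open>Two elements take care of the residue modulo 8, through 4 + 5, 3 + 0, 5 + 0 or 3 + 4;
  the others get 8 or 0.\<close>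

lemma exists_densities:
  fixes S :: "'a set"
  assumes S: "finite S" "card S \<ge> 2" and c: "odd c" "3 \<le> c" "c + 3 \<le> 8 * card S"
  shows "\<exists>f. (\<forall>s. f s \<in> {0, 3, 4, 5, 8}) \<and> (\<Sum>s\<in>S. f s) = int c"
proof -
  obtain x y where xy: "x \<in> S" "y \<in> S" "x \<noteq> y"
    using S by (metis card_2_iff' ex_card subset_eq)
  have *: ?thesis if "q + 2 \<le> card S" "{a, b} \<subseteq> {0, 3, 4, 5, 8}" "int c = a + b + 8 * int q" for q a b
    using exists_densities_two_special[OF S(1) xy that(1,2)] that(3) by simp
  define p where "p = c div 8"
  have "c mod 8 \<in> {1, 3, 5, 7}"
    using c(1) by (auto, presburger)
  moreover have "c = 8 * p + c mod 8"
    by (simp add: p_def)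
  ultimately consider "c = 8 * p + 1" | "c = 8 * p + 3" | "c = 8 * p + 5" | "c = 8 * p + 7"
    by auto
  then show ?thesis
  proof cases
    case 1
    then have "p \<ge> 1" using c by simp
    then show ?thesis
      using 1 c by (intro *[of "p - 1" 4 5]) (simp_all add: of_nat_diff)
  next
    case 2
    show ?thesis
    proof (cases "p + 2 \<le> card S")
      case True
      then show ?thesis using 2 by (intro *[of p 3 0]) simp_all
    next
      case False
      \<comment> \<open>Too few elements remain for \<open>p\<close> values 8, so the special value
        0 is raised to 8.\<close>
      then have "p \<ge> 1" using S(2) by simp
      then show ?thesis
        using 2 c by (intro *[of "p - 1" 3 8]) (simp_all add: of_nat_diff)
    qed
  next
    case 3
    show ?thesis
    proof (cases "p + 2 \<le> card S")
      case True
      then show ?thesis using 3 by (intro *[of p 5 0]) simp_all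
    next
      case False
      then have "p \<ge> 1" using S(2) by simp
      then show ?thesis
        using 3 c by (intro *[of "p - 1" 5 8]) (simp_all add: of_nat_diff)
    qed
  next
    case 4
    then show ?thesis
      using c by (intro *[of p 3 4]) simp_all
  qed
qed

lemma exists_layered_colouring:
  assumes fam: "\<And>a. a \<in> {0, 3, 4, 5, 8} \<Longrightarrow> balanced_family S e a"
    and mp: "multipartite m n k z \<theta>" and "k \<ge> 1"
    and c: "odd c" "3 \<le> c" "c + 3 \<le> 8 * 4 ^ k"
  shows "\<exists>C. depends_on m n C \<and> (\<forall>v p. nbsum m n (\<lambda>w. of_bool (C w p)) v +
     S (\<lambda>q. of_bool (C v q)) p = int c + e * of_bool (C v p))"
proof -
  have card: "card {p :: v4 list. length p = k} = 4 ^ k"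
    using card_lists_length_eq[of "UNIV :: v4 set" k] by simp
  have "(4 :: nat) ^ 1 \<le> 4 ^ k"
    using \<open>k \<ge> 1\<close> by (intro power_increasing) auto
  then obtain d :: "v4 list \<Rightarrow> int" where d: "\<And>p. d p \<in> {0, 3, 4, 5, 8}"
    "(\<Sum>p\<in>{p. length p = k}. d p) = int c"
    using exists_densities[of "{p :: v4 list. length p = k}" c] c finite_v4_lists[of k]
    unfolding card by auto
  have "\<forall>p. \<exists>B :: v8 \<Rightarrow> 'a \<Rightarrow> bool. (\<forall>t v. S (\<lambda>w. of_bool (B t w)) v = d p + e * of_bool (B t v)) \<and>
     (\<forall>v. (\<Sum>t\<in>UNIV. of_bool (B t v)) = d p)"
    using fam[OF d(1)] unfolding balanced_family_def by blast
  then obtain B :: "v4 list \<Rightarrow> v8 \<Rightarrow> 'a \<Rightarrow> bool"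
    where B: "\<And>p t v. S (\<lambda>w. of_bool (B p t w)) v = d p + e * of_bool (B p t v)"
      "\<And>p v. (\<Sum>t\<in>UNIV. of_bool (B p t v)) = d p"
    by metis
  define C where "C v = B (z v) (\<theta> v)" for v
  have "depends_on m n C"
    using mp unfolding multipartite_def depends_on_def C_def by (metis (no_types, lifting))
  moreover have "nbsum m n (\<lambda>w. of_bool (C w p)) v + S (\<lambda>q. of_bool (C v q)) p =
    int c + e * of_bool (C v p)" for v p
  proof -
    have len: "length (z v) = k"
      using mp unfolding multipartite_def by blast
    have "nbsum m n (\<lambda>w. of_bool (C w p)) v =
      (\<Sum>q\<in>{q. length q = k} - {z v}. \<Sum>t\<in>UNIV. of_bool (B q t p))"
      unfolding C_def
      by (rule mp[unfolded multipartite_def, THEN conjunct2, THEN conjunct2, THEN conjunct2,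
          rule_format, of "\<lambda>q t. of_bool (B q t p)"])
    \<comment> \<open>Every part \<open>q\<close> other than that of \<open>v\<close> contributes
      its density \<open>d q\<close>; the missing \<open>d (z v)\<close> comes from inside the small
      factor.\<close>
    also have "\<dots> = int c - d (z v)"
      using d(2) len finite_v4_lists[of k] by (simp only: B(2)) (simp add: sum_diff1)
    finally show ?thesis
      by (simp add: B(1) C_def)
  qed
  ultimately show ?thesis by blast
qed

text \<open>The count of the second colour follows from regularity of degree
  \<open>c + b + e\<close>. Both colours occur because the off-diagonal entries are
  positive.\<close>

lemma exists_perfect_2_coloring:
  assumes col: "\<And>v. nbsum m n (\<lambda>w. of_bool (col w)) v = c + e * of_bool (col v)"
    and deg: "int (6 * m + 3 * n) = c + b + e" and pos: "b > 0" "c > 0"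
  shows "\<exists>f. perfect_2_coloring (D_verts m n) (D_adj m n) f
    (vector [vector [c + e, b], vector [c, b + e]])"
proof -
  define f :: "D_vertex \<Rightarrow> 2" where "f v = (if col v then 1 else 2)" for v
  have compl: "nbsum m n (\<lambda>w. of_bool (\<not> col w)) v = c + b + e - nbsum m n (\<lambda>w. of_bool (col w)) v" for v
  proof -
    have "card (- {a :: z4}) = 3" for a
      unfolding Compl_eq_Diff_UNIV by (simp add: card_Diff_singleton)
    moreover have "card shrikhande_connection = 6"
      by (simp add: shrikhande_connection_def)
    ultimately show ?thesis
      using deg by (simp add: nbsum_def shrikhande_sum_def of_bool_not_iff sum_subtractf
          del: sum_of_bool_eq split: prod.split)
  qed
  have count: "int (card {w \<in> D_verts m n. D_adj m n v w \<and> f w = j}) =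
    vector [vector [c + e, b], vector [c, b + e]] $ f v $ j" if "v \<in> D_verts m n" for v j
  proof -
    have eq: "f w = 1 \<longleftrightarrow> col w" "f w = 2 \<longleftrightarrow> \<not> col w" for w
      by (simp_all add: f_def)
    have fv: "f v = (if col v then 1 else 2)"
      by (simp add: f_def)
    show ?thesis
      using exhaust_2[of j] card_D_neighbours[OF that, of col] card_D_neighbours[OF that, of "\<lambda>w. \<not> col w"]
        compl[of v] col[of v]
      by (cases "col v") (auto simp: eq fv)
  qed
  have "f ` D_verts m n = {1, 2}"
  proof -
    have "(\<lambda>i\<in>{..<m}. 0, \<lambda>j\<in>{..<n}. 0) \<in> D_verts m n"
      by (auto simp: D_verts_def)
    then obtain v where v: "v \<in> D_verts m n" by blast
    have "\<exists>w\<in>D_verts m n. f w = j" if "j \<noteq> f v" for j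
    proof -
      have "vector [vector [c + e, b], vector [c, b + e]] $ f v $ j > 0"
        using that pos exhaust_2[of j] exhaust_2[of "f v"] by auto
      then have "card {w \<in> D_verts m n. D_adj m n v w \<and> f w = j} > 0"
        using count[OF v, of j] by linarith
      then show ?thesis
        by (metis (mono_tags, lifting) card.empty empty_Collect_eq less_irrefl)
    qed
    then have "j \<in> f ` D_verts m n" for j
      using v by (cases "j = f v") auto
    moreover have "{1, 2} = (UNIV :: 2 set)"
      using UNIV_2 by simp
    ultimately show ?thesis by auto
  qed
  then show ?thesis
    using count unfolding perfect_2_coloring_def by blast
qed

theorem theorem7:
  fixes b c l :: nat
  assumes "b > 0" and "c > 0"
    and "gcd b c = 1"
    and "b \<noteq> 1" and "c \<noteq> 1"
    and "l \<ge> 3"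
    and "b + c = 2 ^ (2 * l - 1)"
  shows "(\<forall>m n :: nat. m \<ge> 1 \<and> n \<ge> 8 \<and> real (2 * m + n) = (real b + real c - 2) / 3 \<longrightarrow>
            (\<exists>f. perfect_2_coloring (D_verts m n) (D_adj m n) f
                   (vector [vector [int c - 2, int b],
                            vector [int c, int b - 2]])))
       \<and> (\<forall>n :: nat. real n = (real b + real c + 1) / 3 \<longrightarrow>
            (\<exists>f. perfect_2_coloring (hamming4_verts n) (hamming4_adj n) f
                   (vector [vector [int c + 1, int b],
                            vector [int c, int b + 1]])))"
proof -
  define k where "k = l - 2"
  have k: "k \<ge> 1" and "2 * l - 1 = 3 + 2 * k"
    using assms(6) by (simp_all add: k_def)
  then have bc: "b + c = 8 * 4 ^ k"
    using assms(7) by (simp add: power_add power_mult)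
  have "even (b + c)"
    using bc by simp
  \<comment> \<open>Coprimality and the even sum make \<open>b\<close> and \<open>c\<close> odd; as
    neither is 1, both are at least 3, and \<open>3 \<le> b\<close> gives the upper bound on
    \<open>c\<close>.\<close>
  moreover have "\<not> (even b \<and> even c)"
    using assms(3) by (metis gcd_greatest numeral_One numeral_eq_iff semiring_norm(85) nat_dvd_1_iff_1)
  ultimately have odd: "odd b" "odd c" by auto
  then have "b \<ge> 3" "c \<ge> 3"
    using assms(4,5) by (auto elim!: oddE)
  then have c: "odd c" "3 \<le> c" "c + 3 \<le> 8 * 4 ^ k"
    using odd bc by auto
  have "\<exists>f. perfect_2_coloring (D_verts m n) (D_adj m n) f
      (vector [vector [int c - 2, int b], vector [int c, int b - 2]])"
    if mn: "m \<ge> 1" "n \<ge> 8" "real (2 * m + n) = (real b + real c - 2) / 3" for m n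
  proof -
    \<comment> \<open>The last Shrikhande factor serves as the small factor; this lowers
      \<open>3 * (2 * m + n)\<close> by 6.\<close>
    obtain m' where m: "m = Suc m'"
      using mn(1) by (cases m) auto
    have "real (3 * (2 * m + n) + 2) = real (b + c)"
      using mn(3) by (simp add: field_simps)
    then have deg: "3 * (2 * m + n) + 2 = b + c"
      by (simp only: of_nat_eq_iff)
    then have "3 * (2 * m' + n) + 8 = 8 * 4 ^ k"
      using bc m by simp
    then obtain z \<theta> where "multipartite m' n k z \<theta>"
      using exists_multipartite mn(2) by blast
    then obtain C where C: "depends_on m' n C" "\<And>v p. nbsum m' n (\<lambda>w. of_bool (C w p)) v +
       shrikhande_sum (\<lambda>q. of_bool (C v q)) p = int c + - 2 * of_bool (C v p)"
      using exists_layered_colouring[OF shrikhande_families _ k c] by blast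
    define col where "col = (\<lambda>(x, u). C (x, u) (x m'))"
    have "nbsum m n (\<lambda>w. of_bool (col w)) (x, u) = int c + - 2 * of_bool (col (x, u))" for x u
    proof -
      have "C (x(m' := p), u) = C (x, u)" for p
        by (rule depends_onD[OF C(1)]) auto
      moreover have "nbsum m' n (\<lambda>w. of_bool (col w)) (x, u) =
        nbsum m' n (\<lambda>w. of_bool (C w (x m'))) (x, u)"
        by (rule nbsum_cong) (auto simp: col_def)
      ultimately show ?thesis
        using C(2)[of "x m'" "(x, u)"] by (simp add: m nbsum_Suc_left col_def)
    qed
    then show ?thesis
      using exists_perfect_2_coloring[of m n col "int c" "- 2" "int b"] deg assms(1,2)
      by (simp add: split_paired_all)
  qed
  moreover have "\<exists>f. perfect_2_coloring (hamming4_verts n) (hamming4_adj n) f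
      (vector [vector [int c + 1, int b], vector [int c, int b + 1]])"
    if n: "real n = (real b + real c + 1) / 3" for n
  proof -
    have "real (3 * n) = real (b + c + 1)"
      using n by (simp add: field_simps)
    then have deg: "3 * n = b + c + 1"
      by (simp only: of_nat_eq_iff)
    moreover have "(4 :: nat) ^ 1 \<le> 4 ^ k"
      using k by (intro power_increasing) auto
    ultimately have "n \<ge> 11"
      using bc by simp
    \<comment> \<open>The last three coordinates form the cube of \<open>K4\<close>, and at least 8
      others remain.\<close>
    define n' where "n' = n - 3"
    have n': "n = Suc (Suc (Suc n'))" "n' \<ge> 8"
      using \<open>n \<ge> 11\<close> by (simp_all add: n'_def)
    have "3 * (2 * 0 + n') + 8 = 8 * 4 ^ k"
      using bc deg n' by simp
    then obtain z \<theta> where "multipartite 0 n' k z \<theta>"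
      using exists_multipartite n'(2) by blast
    then obtain C where C: "depends_on 0 n' C" "\<And>v p. nbsum 0 n' (\<lambda>w. of_bool (C w p)) v +
       K4_cube_sum (\<lambda>q. of_bool (C v q)) p = int c + 1 * of_bool (C v p)"
      using exists_layered_colouring[OF K4_cube_families _ k c] by blast
    define q where "q u = (u n', u (Suc n'), u (Suc (Suc n')))" for u :: "nat \<Rightarrow> z4"
    define col where "col = (\<lambda>(x, u). C (x, u) (q u))"
    have "nbsum 0 n (\<lambda>w. of_bool (col w)) (x, u) = int c + 1 * of_bool (col (x, u))" for x u
    proof -
      have "C (x, u(n' := p)) = C (x, u)" "C (x, u(Suc n' := p)) = C (x, u)"
        "C (x, u(Suc (Suc n') := p)) = C (x, u)" for p
        by (rule depends_onD[OF C(1)]; simp)+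
      moreover have "nbsum 0 n' (\<lambda>w. of_bool (col w)) (x, u) =
        nbsum 0 n' (\<lambda>w. of_bool (C w (q u))) (x, u)"
        by (rule nbsum_cong) (auto simp: col_def q_def)
      ultimately show ?thesis
        using C(2)[of "q u" "(x, u)"]
        by (simp add: n'(1) nbsum_Suc_right col_def q_def K4_cube_sum_def del: sum_of_bool_eq)
    qed
    then show ?thesis
      using exists_perfect_2_coloring[of 0 n col "int c" 1 "int b"] deg assms(1,2)
      by (simp add: split_paired_all)
  qed
  ultimately show ?thesis by blast
qed

end
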